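(* (Decomposition for Finite Commutative A-loops.) Let $Q$ be a finite commutative A-loop. Let $K(Q)=\{x\in Q : |x| \text{ is odd}\}$ and $H(Q)=\{x\in Q : x^{2^n}=1 \text{ for some integer } n\ge 0\}$. Then $K(Q)$ and $H(Q)$ are subloops and $Q = K(Q)\times H(Q)$ (internal direct product).
   Context: A loop is a set $Q$ with a binary operation and neutral element $1$ such that all left and right translations $L_x:y\mapsto xy$, $R_x:y\mapsto yx$ are bijections. $\mathrm{Mlt}(Q)$ is the group generated by all $L_x,R_x$, and $\mathrm{Inn}(Q)$ is the stabilizer of $1$ in it. A commutative A-loop is a commutative loop in which every element of $\mathrm{Inn}(Q)$ is an automorphism. Powers are defined by $x^n = 1L_x^n$ ($n\in\mathbb{Z}$); commutative A-loops are power-associative (each element generates a cyclic group), and $|x|$ denotes the order of $x$, i.e. the order of the cyclic subgroup generated by $x$. *)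

theory Defs
  imports Main
begin

definition is_loop :: "'a set \<Rightarrow> ('a \<Rightarrow> 'a \<Rightarrow> 'a) \<Rightarrow> 'a \<Rightarrow> bool" where
  "is_loop Q m e \<longleftrightarrow> e \<in> Q \<and> (\<forall>x\<in>Q. \<forall>y\<in>Q. m x y \<in> Q)
     \<and> (\<forall>x\<in>Q. m e x = x \<and> m x e = x)
     \<and> (\<forall>x\<in>Q. bij_betw (\<lambda>y. m x y) Q Q \<and> bij_betw (\<lambda>y. m y x) Q Q)"

definition lmap :: "'a set \<Rightarrow> ('a \<Rightarrow> 'a \<Rightarrow> 'a) \<Rightarrow> 'a \<Rightarrow> 'a \<Rightarrow> 'a" where
  "lmap Q m x y = (if y \<in> Q then m x y else y)"

definition rmap :: "'a set \<Rightarrow> ('a \<Rightarrow> 'a \<Rightarrow> 'a) \<Rightarrow> 'a \<Rightarrow> 'a \<Rightarrow> 'a" where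
  "rmap Q m x y = (if y \<in> Q then m y x else y)"

definition lmap_inv :: "'a set \<Rightarrow> ('a \<Rightarrow> 'a \<Rightarrow> 'a) \<Rightarrow> 'a \<Rightarrow> 'a \<Rightarrow> 'a" where
  "lmap_inv Q m x y = (if y \<in> Q then (THE z. z \<in> Q \<and> m x z = y) else y)"

definition rmap_inv :: "'a set \<Rightarrow> ('a \<Rightarrow> 'a \<Rightarrow> 'a) \<Rightarrow> 'a \<Rightarrow> 'a \<Rightarrow> 'a" where
  "rmap_inv Q m x y = (if y \<in> Q then (THE z. z \<in> Q \<and> m z x = y) else y)"

inductive_set mlt :: "'a set \<Rightarrow> ('a \<Rightarrow> 'a \<Rightarrow> 'a) \<Rightarrow> ('a \<Rightarrow> 'a) set"
  for Q m where
  mlt_id: "id \<in> mlt Q m"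
| mlt_L: "f \<in> mlt Q m \<Longrightarrow> x \<in> Q \<Longrightarrow> lmap Q m x \<circ> f \<in> mlt Q m"
| mlt_R: "f \<in> mlt Q m \<Longrightarrow> x \<in> Q \<Longrightarrow> rmap Q m x \<circ> f \<in> mlt Q m"
| mlt_Li: "f \<in> mlt Q m \<Longrightarrow> x \<in> Q \<Longrightarrow> lmap_inv Q m x \<circ> f \<in> mlt Q m"
| mlt_Ri: "f \<in> mlt Q m \<Longrightarrow> x \<in> Q \<Longrightarrow> rmap_inv Q m x \<circ> f \<in> mlt Q m"

definition inn :: "'a set \<Rightarrow> ('a \<Rightarrow> 'a \<Rightarrow> 'a) \<Rightarrow> 'a \<Rightarrow> ('a \<Rightarrow> 'a) set" where
  "inn Q m e = {f \<in> mlt Q m. f e = e}"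

definition is_comm_A_loop :: "'a set \<Rightarrow> ('a \<Rightarrow> 'a \<Rightarrow> 'a) \<Rightarrow> 'a \<Rightarrow> bool" where
  "is_comm_A_loop Q m e \<longleftrightarrow> is_loop Q m e
     \<and> (\<forall>x\<in>Q. \<forall>y\<in>Q. m x y = m y x)
     \<and> (\<forall>f\<in>inn Q m e. \<forall>x\<in>Q. \<forall>y\<in>Q. f (m x y) = m (f x) (f y))"

definition lpow :: "'a set \<Rightarrow> ('a \<Rightarrow> 'a \<Rightarrow> 'a) \<Rightarrow> 'a \<Rightarrow> 'a \<Rightarrow> int \<Rightarrow> 'a" where
  "lpow Q m e x n = (if n \<ge> 0 then (lmap Q m x ^^ nat n) e
                     else (lmap_inv Q m x ^^ nat (- n)) e)"

definition elem_order :: "'a set \<Rightarrow> ('a \<Rightarrow> 'a \<Rightarrow> 'a) \<Rightarrow> 'a \<Rightarrow> 'a \<Rightarrow> nat" where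
  "elem_order Q m e x = card {lpow Q m e x n | n. True}"

definition Kpart :: "'a set \<Rightarrow> ('a \<Rightarrow> 'a \<Rightarrow> 'a) \<Rightarrow> 'a \<Rightarrow> 'a set" where
  "Kpart Q m e = {x \<in> Q. odd (elem_order Q m e x)}"

definition Hpart :: "'a set \<Rightarrow> ('a \<Rightarrow> 'a \<Rightarrow> 'a) \<Rightarrow> 'a \<Rightarrow> 'a set" where
  "Hpart Q m e = {x \<in> Q. \<exists>n::nat. lpow Q m e x (2 ^ n) = e}"

definition is_subloop :: "'a set \<Rightarrow> 'a set \<Rightarrow> ('a \<Rightarrow> 'a \<Rightarrow> 'a) \<Rightarrow> 'a \<Rightarrow> bool" where
  "is_subloop S Q m e \<longleftrightarrow> S \<subseteq> Q \<and> is_loop S m e"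

definition internal_direct_product ::
  "'a set \<Rightarrow> ('a \<Rightarrow> 'a \<Rightarrow> 'a) \<Rightarrow> 'a set \<Rightarrow> 'a set \<Rightarrow> bool" where
  "internal_direct_product Q m K H \<longleftrightarrow>
     bij_betw (\<lambda>(k, h). m k h) (K \<times> H) Q
     \<and> (\<forall>k1\<in>K. \<forall>k2\<in>K. \<forall>h1\<in>H. \<forall>h2\<in>H.
          m (m k1 h1) (m k2 h2) = m (m k1 k2) (m h1 h2))"

end

theory Submission
  imports Defs "HOL-Computational_Algebra.Primes"
begin

text \<open>In a commutative A-loop the inner maps \<open>L\<^bsub>xy\<^esub>\<^sup>-\<^sup>1 L\<^bsub>x\<^esub> L\<^bsub>y\<^esub>\<close> are automorphisms fixing
  \<open>x\<close>. This yields power associativity, the identity \<open>(x y)\<^sup>-\<^sup>1 = x\<^sup>-\<^sup>1 y\<^sup>-\<^sup>1\<close>, and the fact that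
  a product of two squares is a square. The last fact, applied repeatedly, shows that the
  \<open>2\<^sup>n\<close>-th powers form a subloop, which is \<open>K(Q)\<close> for large \<open>n\<close>. By the second, the elements
  with \<open>x = x\<^sup>-\<^sup>1\<close> form a subloop, and applying this modulo \<open>{x. x\<^bsup>2^n\<^esup> = 1}\<close> shows inductively
  that \<open>H(Q)\<close> is a subloop. Both are invariant under inner maps, hence normal; they meet
  trivially and every \<open>x\<close> is the product of two of its powers, one in each, so \<open>Q\<close> is their
  direct product.\<close>

text \<open>The automorphism property \<open>inner_mult\<close> is stated without division, so that it passes to
  subsets closed under multiplication.\<close>

locale comm_A_loop =
  fixes Q :: "'a set" and m :: "'a \<Rightarrow> 'a \<Rightarrow> 'a" (infixl "\<cdot>" 70) and e :: 'a
  assumes e_closed [simp]: "e \<in> Q"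
    and m_closed [simp]: "\<lbrakk>x \<in> Q; y \<in> Q\<rbrakk> \<Longrightarrow> x \<cdot> y \<in> Q"
    and m_e_left [simp]: "x \<in> Q \<Longrightarrow> e \<cdot> x = x"
    and m_comm: "\<lbrakk>x \<in> Q; y \<in> Q\<rbrakk> \<Longrightarrow> x \<cdot> y = y \<cdot> x"
    and div_exists: "\<lbrakk>x \<in> Q; y \<in> Q\<rbrakk> \<Longrightarrow> \<exists>z\<in>Q. x \<cdot> z = y"
    and m_cancel: "\<lbrakk>x \<cdot> y = x \<cdot> z; x \<in> Q; y \<in> Q; z \<in> Q\<rbrakk> \<Longrightarrow> y = z"
    and inner_mult: "\<lbrakk>x \<cdot> (y \<cdot> u) = x \<cdot> y \<cdot> u'; x \<cdot> (y \<cdot> v) = x \<cdot> y \<cdot> v';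
        x \<in> Q; y \<in> Q; u \<in> Q; v \<in> Q; u' \<in> Q; v' \<in> Q\<rbrakk>
      \<Longrightarrow> x \<cdot> (y \<cdot> (u \<cdot> v)) = x \<cdot> y \<cdot> (u' \<cdot> v')"
begin

section \<open>Division, inverses and inner maps\<close>

definition ldiv :: "'a \<Rightarrow> 'a \<Rightarrow> 'a" where
  "ldiv x y = (THE z. z \<in> Q \<and> x \<cdot> z = y)"

definition inv :: "'a \<Rightarrow> 'a" where
  "inv x = ldiv x e"

definition inner :: "'a \<Rightarrow> 'a \<Rightarrow> 'a \<Rightarrow> 'a" where
  "inner x y u = ldiv (x \<cdot> y) (x \<cdot> (y \<cdot> u))"

primrec pw :: "'a \<Rightarrow> nat \<Rightarrow> 'a" where
  "pw x 0 = e"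
| "pw x (Suc n) = x \<cdot> pw x n"

lemma m_e_right [simp]: "x \<in> Q \<Longrightarrow> x \<cdot> e = x"
  using m_comm[of x e] by simp

lemma ldiv_unique: "\<lbrakk>x \<cdot> z = y; x \<in> Q; z \<in> Q\<rbrakk> \<Longrightarrow> ldiv x y = z"
  unfolding ldiv_def by (rule the_equality) (auto intro: m_cancel)

lemma ldiv_closed [simp]: "\<lbrakk>x \<in> Q; y \<in> Q\<rbrakk> \<Longrightarrow> ldiv x y \<in> Q"
  using div_exists ldiv_unique by metis

lemma m_ldiv [simp]: "\<lbrakk>x \<in> Q; y \<in> Q\<rbrakk> \<Longrightarrow> x \<cdot> ldiv x y = y"
  using div_exists ldiv_unique by metis

lemma inv_closed [simp]: "x \<in> Q \<Longrightarrow> inv x \<in> Q"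
  by (simp add: inv_def)

lemma m_inv_right [simp]: "x \<in> Q \<Longrightarrow> x \<cdot> inv x = e"
  by (simp add: inv_def)

lemma m_inv_left [simp]: "x \<in> Q \<Longrightarrow> inv x \<cdot> x = e"
  using m_comm[of x "inv x"] by simp

lemma inv_unique: "\<lbrakk>x \<cdot> z = e; x \<in> Q; z \<in> Q\<rbrakk> \<Longrightarrow> inv x = z"
  by (simp add: inv_def ldiv_unique)

lemma inv_inv [simp]: "x \<in> Q \<Longrightarrow> inv (inv x) = x"
  by (simp add: inv_unique)

lemma inner_closed [simp]: "\<lbrakk>x \<in> Q; y \<in> Q; u \<in> Q\<rbrakk> \<Longrightarrow> inner x y u \<in> Q"
  by (simp add: inner_def)

lemma m_inner [simp]:
  "\<lbrakk>x \<in> Q; y \<in> Q; u \<in> Q\<rbrakk> \<Longrightarrow> x \<cdot> y \<cdot> inner x y u = x \<cdot> (y \<cdot> u)"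
  by (simp add: inner_def)

lemma inner_unique:
  "\<lbrakk>x \<cdot> y \<cdot> u' = x \<cdot> (y \<cdot> u); x \<in> Q; y \<in> Q; u' \<in> Q\<rbrakk> \<Longrightarrow> inner x y u = u'"
  by (simp add: inner_def ldiv_unique)

lemma inner_hom:
  assumes "x \<in> Q" "y \<in> Q" "u \<in> Q" "v \<in> Q"
  shows "inner x y (u \<cdot> v) = inner x y u \<cdot> inner x y v"
  using assms by (intro inner_unique inner_mult[symmetric]) simp_all

lemma inner_e [simp]: "\<lbrakk>x \<in> Q; y \<in> Q\<rbrakk> \<Longrightarrow> inner x y e = e"
  by (rule inner_unique) simp_all

lemma inner_inv:
  assumes "x \<in> Q" "y \<in> Q" "u \<in> Q"
  shows "inner x y (inv u) = inv (inner x y u)"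
  using assms inner_hom[of x y u "inv u"] by (intro inv_unique[symmetric]) simp_all

lemma inner_inj:
  assumes "inner x y u = inner x y v" "x \<in> Q" "y \<in> Q" "u \<in> Q" "v \<in> Q"
  shows "u = v"
  using assms m_inner[of x y u] m_inner[of x y v]
  by (metis m_cancel m_closed)

text \<open>Commutativity gives \<open>x (y x) = (x y) x\<close>.\<close>

lemma inner_self [simp]: "\<lbrakk>x \<in> Q; y \<in> Q\<rbrakk> \<Longrightarrow> inner x y x = x"
  using m_comm[of y x] m_comm[of "x \<cdot> y" x] by (intro inner_unique) simp_all

lemma pw_closed [simp]: "x \<in> Q \<Longrightarrow> pw x n \<in> Q"
  by (induction n) simp_all

lemma inner_pw: "\<lbrakk>x \<in> Q; y \<in> Q; u \<in> Q\<rbrakk> \<Longrightarrow> inner x y (pw u n) = pw (inner x y u) n"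
  by (induction n) (simp_all add: inner_hom)

text \<open>Since \<^term>\<open>inner x y\<close> is an automorphism fixing \<^term>\<open>x\<close>, it fixes every power
  of \<^term>\<open>x\<close>; power associativity follows.\<close>

lemma m_pw_assoc: "\<lbrakk>x \<in> Q; y \<in> Q\<rbrakk> \<Longrightarrow> x \<cdot> (y \<cdot> pw x n) = x \<cdot> y \<cdot> pw x n"
  using m_inner[of x y "pw x n"] by (simp add: inner_pw)

text \<open>The automorphism \<open>inner x y\<close> fixes \<open>x\<close>, hence also
  \<open>inv x\<close>, so \<open>x (y (inv x)) = (x y) (inv x)\<close>; commutativity rearranges
  both sides.\<close>

lemma m_inv_left_commute:
  assumes "x \<in> Q" "y \<in> Q"
  shows "x \<cdot> (inv x \<cdot> y) = inv x \<cdot> (x \<cdot> y)"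
  using assms m_inner[of x y "inv x"] m_comm[of y "inv x"] m_comm[of "x \<cdot> y" "inv x"]
  by (simp add: inner_inv)

lemma pw_add: "x \<in> Q \<Longrightarrow> pw x (a + b) = pw x a \<cdot> pw x b"
  by (induction a) (simp_all add: m_pw_assoc)

lemma pw_mult: "x \<in> Q \<Longrightarrow> pw x (a * b) = pw (pw x a) b"
  by (induction b) (simp_all add: pw_add)

lemma pw_e [simp]: "pw e n = e"
  by (induction n) simp_all

lemma pw_2: "x \<in> Q \<Longrightarrow> pw x 2 = x \<cdot> x"
  by (simp add: numeral_2_eq_2)

lemma pw_diff_eq_e:
  assumes "i \<le> j" "pw x i = pw x j" and [simp]: "x \<in> Q"
  shows "pw x (j - i) = e"
proof (rule m_cancel)
  show "pw x i \<cdot> pw x (j - i) = pw x i \<cdot> e"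
    using assms pw_add[of x i "j - i"] by simp
qed simp_all

text \<open>The automorphism \<open>inner x y\<close> is applied to \<open>inv y \<cdot> w\<close>,
  where \<open>y \<cdot> w = inv x\<close>. Comparing its defining equation with the product of the
  images of \<open>inv y\<close> and \<open>w\<close> determines
  \<open>x \<cdot> (inv y \<cdot> inv x)\<close>, and \<open>x\<close> cancels.\<close>

lemma inv_mult:
  assumes [simp]: "x \<in> Q" "y \<in> Q"
  shows "inv (x \<cdot> y) = inv x \<cdot> inv y"
proof -
  define p where "p = x \<cdot> y"
  define w where "w = ldiv y (inv x)"
  have [simp]: "p \<in> Q" "w \<in> Q" by (simp_all add: p_def w_def)
  have "y \<cdot> w = inv x" by (simp add: w_def)
  then have w: "inner x y w = inv p"
    by (intro inner_unique) (simp_all flip: p_def)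
  define q where "q = inner x y (inv y)"
  have [simp]: "q \<in> Q" by (simp add: q_def)
  have pq: "p \<cdot> q = x"
    by (simp add: p_def q_def)
  have "x \<cdot> (inv y \<cdot> inv x) = x \<cdot> (y \<cdot> (inv y \<cdot> w))"
    by (simp add: \<open>y \<cdot> w = inv x\<close> m_inv_left_commute)
  also have "\<dots> = p \<cdot> (q \<cdot> inv p)"
    using m_inner[of x y "inv y \<cdot> w"] by (simp add: inner_hom w flip: p_def q_def)
  also have "\<dots> = inv p \<cdot> x"
    using m_inv_left_commute[of p q] m_comm[of q "inv p"] pq by simp
  also have "\<dots> = x \<cdot> inv p" by (simp add: m_comm)
  finally have "inv y \<cdot> inv x = inv p" by (rule m_cancel) simp_all
  then show ?thesis by (simp add: p_def m_comm)
qed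

text \<open>Inversion is multiplicative and commutes with \<open>inner x y\<close>, so it carries
  the equation defining \<open>inner x y (inv u)\<close> to the one defining
  \<open>inner (inv x) (inv y) u\<close>.\<close>

lemma inner_inv_inv:
  assumes [simp]: "x \<in> Q" "y \<in> Q" "u \<in> Q"
  shows "inner (inv x) (inv y) u = inner x y u"
proof (rule inner_unique)
  have "inv (x \<cdot> y \<cdot> inner x y (inv u)) = inv (x \<cdot> (y \<cdot> inv u))" by simp
  then show "inv x \<cdot> inv y \<cdot> inner x y u = inv x \<cdot> (inv y \<cdot> u)"
    by (simp add: inv_mult inner_inv del: m_inner)
qed simp_all

lemma square_mult:
  assumes [simp]: "x \<in> Q" "y \<in> Q"
  shows "(x \<cdot> y) \<cdot> (x \<cdot> y) = x \<cdot> (y \<cdot> ldiv (inv y) x)"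
proof -
  define z where "z = ldiv (inv y) x"
  have [simp]: "z \<in> Q" by (simp add: z_def)
  \<comment> \<open>Both sides multiplied by \<open>inv x \<cdot> inv y\<close> give
    \<open>e\<close>, because \<open>inv y \<cdot> z = x\<close>.\<close>
  have "inner (inv x) (inv y) z = x \<cdot> y"
    by (rule inner_unique) (simp_all add: z_def flip: inv_mult)
  then have "inner x y z = x \<cdot> y" by (simp add: inner_inv_inv)
  then show ?thesis using m_inner[of x y z] by (simp add: z_def)
qed

text \<open>Put \<open>u = inner (x\<^sup>2) y y\<close> and \<open>p = x\<^sup>2 y\<close>, so that \<open>u\<^sup>-\<^sup>1 p = x\<^sup>2\<close> and
  \<open>u p = x\<^sup>2 y\<^sup>2\<close>. Factoring \<open>x = u\<^sup>-\<^sup>1 c\<close> and \<open>u = c s\<close> gives \<open>p = c s\<^sup>-\<^sup>1\<close>, and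
  \<open>(c s) (c s\<^sup>-\<^sup>1) = (c s\<^sup>-\<^sup>1 s)\<^sup>2\<close>.\<close>

lemma square_mult_square:
  assumes [simp]: "x \<in> Q" "y \<in> Q"
  shows "\<exists>z\<in>Q. z \<cdot> z = x \<cdot> x \<cdot> (y \<cdot> y)"
proof
  define u where "u = inner (x \<cdot> x) y y"
  define p where "p = x \<cdot> x \<cdot> y"
  define c where "c = ldiv (inv u) x"
  define s where "s = ldiv c u"
  have [simp]: "u \<in> Q" "p \<in> Q" "c \<in> Q" "s \<in> Q"
    by (simp_all add: u_def p_def c_def s_def)
  have cs: "c \<cdot> s = u" by (simp add: s_def)
  have up: "p \<cdot> u = x \<cdot> x \<cdot> (y \<cdot> y)"
    by (simp add: u_def p_def)
  have "inv u = inner (x \<cdot> x) y (inv y)"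
    by (simp add: u_def inner_inv)
  then have "p \<cdot> inv u = x \<cdot> x"
    by (simp add: p_def)
  moreover have "ldiv (inv c) (inv u) = inv s"
    by (rule ldiv_unique) (simp_all flip: cs inv_mult)
  then have "x \<cdot> x = inv u \<cdot> (c \<cdot> inv s)"
    using square_mult[of "inv u" c] by (simp add: c_def)
  ultimately have "inv u \<cdot> p = inv u \<cdot> (c \<cdot> inv s)"
    by (simp add: m_comm)
  then have p: "p = c \<cdot> inv s" by (rule m_cancel) simp_all
  have "ldiv (inv s) p = c"
    by (rule ldiv_unique) (simp_all add: p m_comm)
  then have "p \<cdot> s \<cdot> (p \<cdot> s) = p \<cdot> u"
    using square_mult[of p s] m_comm[of s c] cs by simp
  then show "p \<cdot> s \<cdot> (p \<cdot> s) = x \<cdot> x \<cdot> (y \<cdot> y)"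
    by (simp add: up)
  show "p \<cdot> s \<in> Q" by simp
qed

lemma is_loop: "is_loop Q m e"
proof -
  have "bij_betw (\<lambda>y. x \<cdot> y) Q Q" if x: "x \<in> Q" for x
    using x div_exists[OF x] by (auto simp: bij_betw_def inj_on_def intro: m_cancel)
  moreover have "bij_betw (\<lambda>y. y \<cdot> x) Q Q \<longleftrightarrow> bij_betw (\<lambda>y. x \<cdot> y) Q Q" if "x \<in> Q" for x
    using that by (intro bij_betw_cong) (simp add: m_comm)
  ultimately show ?thesis by (simp add: is_loop_def)
qed

end

section \<open>Finite loops: subloops, exponents and orders\<close>

locale finite_comm_A_loop = comm_A_loop +
  assumes finite_Q: "finite Q"
begin

text \<open>Translation by an element of \<open>S\<close> is an injective map of the finite set
  \<open>S\<close> into itself, hence onto, so closure under products yields division.\<close>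

lemma subloopI:
  assumes "S \<subseteq> Q" "e \<in> S" and closed: "\<And>x y. \<lbrakk>x \<in> S; y \<in> S\<rbrakk> \<Longrightarrow> x \<cdot> y \<in> S"
  shows "finite_comm_A_loop S m e"
proof
  note SQ = subsetD[OF \<open>S \<subseteq> Q\<close>]
  show "finite S" using assms finite_Q by (blast intro: finite_subset)
  show "\<exists>z\<in>S. x \<cdot> z = y" if "x \<in> S" "y \<in> S" for x y
  proof -
    have "inj_on (\<lambda>z. x \<cdot> z) S"
      using that SQ by (auto simp: inj_on_def intro: m_cancel)
    then have "(\<lambda>z. x \<cdot> z) ` S = S"
      using that \<open>finite S\<close> closed by (intro endo_inj_surj) auto
    then show ?thesis using that by (metis imageE)
  qed
  show "x \<cdot> (y \<cdot> (u \<cdot> v)) = x \<cdot> y \<cdot> (u' \<cdot> v')"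
    if "x \<cdot> (y \<cdot> u) = x \<cdot> y \<cdot> u'" "x \<cdot> (y \<cdot> v) = x \<cdot> y \<cdot> v'"
      "x \<in> S" "y \<in> S" "u \<in> S" "v \<in> S" "u' \<in> S" "v' \<in> S" for x y u v u' v'
    using that SQ by (intro inner_mult) auto
  show "x \<cdot> y = y \<cdot> x" if "x \<in> S" "y \<in> S" for x y
    using that SQ by (intro m_comm) auto
qed (use assms in \<open>auto intro: m_cancel\<close>)

lemma exists_period:
  assumes [simp]: "x \<in> Q"
  shows "\<exists>n>0. pw x n = e"
proof -
  have "\<not> inj (pw x)"
  proof
    assume "inj (pw x)"
    moreover have "finite (range (pw x))"
      by (rule finite_subset[OF _ finite_Q]) auto
    ultimately show False by (auto dest: finite_imageD)
  qed
  then obtain i j where "i < j" "pw x i = pw x j"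
    by (metis linorder_injI)
  then show ?thesis using pw_diff_eq_e[of i j x] by (intro exI[of _ "j - i"]) simp
qed

lemma pw_eq_e_dvd: "\<lbrakk>pw x a = e; a dvd b; x \<in> Q\<rbrakk> \<Longrightarrow> pw x b = e"
  by (auto simp: dvd_def pw_mult)

text \<open>The product of periods of all elements is a common exponent; splitting off its full
  power of 2 leaves an odd factor.\<close>

lemma exists_exponent:
  obtains n k where "odd k" "\<And>x. x \<in> Q \<Longrightarrow> pw x (2 ^ n * k) = e"
proof -
  obtain N where N: "\<And>x. x \<in> Q \<Longrightarrow> N x > 0 \<and> pw x (N x) = e"
    using exists_period by metis
  define M where "M = prod N Q"
  have "M \<noteq> 0" using N finite_Q by (auto simp: M_def)
  then obtain k where "M = 2 ^ multiplicity 2 M * k" "odd k"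
    using multiplicity_decompose'[of M 2] by auto
  moreover have "pw x M = e" if "x \<in> Q" for x
    using N[OF that] that finite_Q by (auto simp: M_def intro: pw_eq_e_dvd)
  ultimately show thesis using that by metis
qed

lemma lpow_of_nat: "x \<in> Q \<Longrightarrow> lpow Q m e x (int n) = pw x n"
  unfolding lpow_def by (induction n) (simp_all add: lmap_def nat_add_distrib)

lemma lpow_neg_pw: "x \<in> Q \<Longrightarrow> \<exists>j. (lmap_inv Q m x ^^ n) e = pw x j"
proof (induction n)
  case 0
  then show ?case by (auto intro: exI[of _ 0])
next
  case (Suc n)
  then obtain j where j: "(lmap_inv Q m x ^^ n) e = pw x j" by auto
  obtain N where N: "N > 0" "pw x N = e" using exists_period Suc.prems by blast
  \<comment> \<open>Adding a period makes the exponent positive, so division by \<open>x\<close>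
    merely lowers it by one, even when \<open>j = 0\<close>.\<close>
  have "pw x j = pw x (j + N)" using N Suc.prems by (simp add: pw_add)
  also have "\<dots> = x \<cdot> pw x (j + N - 1)" using N by (cases N) simp_all
  finally have "ldiv x (pw x j) = pw x (j + N - 1)"
    using Suc.prems by (intro ldiv_unique) simp_all
  then have "lmap_inv Q m x (pw x j) = pw x (j + N - 1)"
    using Suc.prems by (simp add: lmap_inv_def ldiv_def)
  then show ?case using j by auto
qed

text \<open>The powers below the least period run through the cyclic subgroup without repetition,
  and negative powers recur among the natural ones.\<close>

lemma elem_order_least:
  assumes [simp]: "x \<in> Q"
  shows "elem_order Q m e x = (LEAST n. n > 0 \<and> pw x n = e)"
proof -
  define N where "N = (LEAST n. n > 0 \<and> pw x n = e)"
  have N: "N > 0" "pw x N = e"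
    using LeastI_ex[OF exists_period[OF assms]] by (simp_all add: N_def)
  have least: "pw x n \<noteq> e" if "n < N" "n > 0" for n
    using not_less_Least[of n "\<lambda>n. n > 0 \<and> pw x n = e"] that by (auto simp: N_def)
  have "pw x n = pw x (n mod N)" for n
    using pw_add[of x "N * (n div N)" "n mod N"] N by (simp add: pw_mult)
  then have range: "range (pw x) = pw x ` {..<N}"
    using N by (auto intro!: image_eqI[of _ "pw x" "_ mod N"])
  have "{lpow Q m e x n |n. True} = range (pw x)"
  proof -
    have "lpow Q m e x n \<in> range (pw x)" for n
      using lpow_of_nat[of x "nat n"] lpow_neg_pw[of x "nat (- n)"]
      by (cases "n \<ge> 0") (auto simp: lpow_def)
    then show ?thesis using lpow_of_nat[of x] by (auto intro: exI[of _ "int _"])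
  qed
  moreover have "inj_on (pw x) {..<N}"
  proof (rule linorder_inj_onI')
    fix i j assume "i \<in> {..<N}" "j \<in> {..<N}" "i < j"
    show "pw x i \<noteq> pw x j"
    proof
      assume "pw x i = pw x j"
      then have "pw x (j - i) = e" using \<open>i < j\<close> by (simp add: pw_diff_eq_e)
      then show False using least[of "j - i"] \<open>i < j\<close> \<open>j \<in> {..<N}\<close>
        by (simp add: less_imp_diff_less)
    qed
  qed
  ultimately show ?thesis by (simp add: elem_order_def range card_image N_def)
qed

text \<open>The order divides every exponent that kills \<open>x\<close>, so any odd such exponent
  is a witness. In this form membership in \<open>Kpart\<close> transfers along
  homomorphisms.\<close>

lemma odd_elem_order_iff:
  assumes [simp]: "x \<in> Q"
  shows "odd (elem_order Q m e x) \<longleftrightarrow> (\<exists>k. odd k \<and> pw x k = e)"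
proof -
  define N where "N = elem_order Q m e x"
  have "N > 0 \<and> pw x N = e"
    using LeastI_ex[OF exists_period[OF assms]] by (simp add: N_def elem_order_least)
  then have N: "N > 0" "pw x N = e" by simp_all
  have "N dvd k" if "pw x k = e" for k
  proof -
    have "pw x (k mod N) = e"
      using pw_add[of x "N * (k div N)" "k mod N"] N that by (simp add: pw_mult)
    moreover have "k mod N < N" using N by simp
    ultimately have "k mod N = 0"
      using not_less_Least[of "k mod N" "\<lambda>n. n > 0 \<and> pw x n = e"]
      by (auto simp: N_def elem_order_least)
    then show ?thesis by auto
  qed
  then show ?thesis using N dvd_trans unfolding N_def by blast
qed

lemma Kpart_iff: "x \<in> Kpart Q m e \<longleftrightarrow> x \<in> Q \<and> (\<exists>k. odd k \<and> pw x k = e)"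
  unfolding Kpart_def using odd_elem_order_iff by blast

lemma Hpart_iff: "x \<in> Hpart Q m e \<longleftrightarrow> x \<in> Q \<and> (\<exists>n. pw x (2 ^ n) = e)"
  using lpow_of_nat[of x "2 ^ _"] by (auto simp: Hpart_def)

section \<open>The loops of \<open>2^n\<close>-th powers and \<open>K(Q)\<close>\<close>

definition pow2_image :: "nat \<Rightarrow> 'a set" where
  "pow2_image n = (\<lambda>x. pw x (2 ^ n)) ` Q"

lemma pow2_image_subset: "pow2_image n \<subseteq> Q"
  by (auto simp: pow2_image_def)

lemma pow2_image_Suc: "pow2_image (Suc n) = (\<lambda>x. x \<cdot> x) ` pow2_image n"
proof -
  have "pw x (2 ^ Suc n) = pw x (2 ^ n) \<cdot> pw x (2 ^ n)" if "x \<in> Q" for x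
    using that pw_add[of x "2 ^ n" "2 ^ n"] by (simp add: mult_2)
  then show ?thesis by (simp add: pow2_image_def image_image)
qed

lemma pow2_image_loop: "finite_comm_A_loop (pow2_image n) m e"
proof (induction n)
  case 0
  have "pow2_image 0 = Q" by (auto simp: pow2_image_def)
  then show ?case by (simp add: finite_comm_A_loop_axioms)
next
  case (Suc n)
  \<comment> \<open>The square root of a product of two squares must itself be a
    \<open>2^n\<close>-th power, so \<open>square_mult_square\<close> is applied inside
    \<open>pow2_image n\<close> instead of \<open>Q\<close>.\<close>
  then interpret S: finite_comm_A_loop "pow2_image n" m e .
  show ?case
  proof (rule subloopI)
    show "e \<in> pow2_image (Suc n)"
      unfolding pow2_image_Suc by (rule image_eqI[of _ _ e]) simp_all
    show "x \<cdot> y \<in> pow2_image (Suc n)"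
      if xy: "x \<in> pow2_image (Suc n)" "y \<in> pow2_image (Suc n)" for x y
    proof -
      obtain a b where "a \<in> pow2_image n" "x = a \<cdot> a" "b \<in> pow2_image n" "y = b \<cdot> b"
        using xy by (auto simp: pow2_image_Suc)
      then obtain z where "z \<in> pow2_image n" "z \<cdot> z = x \<cdot> y"
        using S.square_mult_square[of a b] by auto
      then show ?thesis by (auto simp: pow2_image_Suc intro: rev_image_eqI)
    qed
  qed (rule pow2_image_subset)
qed

text \<open>If \<open>x\<close> has odd period \<open>j\<close>, then \<open>2^n\<close> is
  invertible modulo \<open>j\<close>, so \<open>x\<close> is a \<open>2^n\<close>-th power of one of
  its own powers. Conversely, \<open>k\<close> kills every \<open>2^n\<close>-th power.\<close>

lemma Kpart_eq_pow2_image: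
  assumes "odd k" and exponent: "\<And>x. x \<in> Q \<Longrightarrow> pw x (2 ^ n * k) = e"
  shows "Kpart Q m e = pow2_image n"
proof (intro subset_antisym subsetI)
  fix x assume "x \<in> Kpart Q m e"
  then obtain j where [simp]: "x \<in> Q" and j: "odd j" "pw x j = e"
    by (auto simp: Kpart_iff)
  have "coprime (2 ^ n) j" using j by simp
  then obtain a b where "2 ^ n * a = j * b + 1"
    using bezout_nat[of "2 ^ n" j] by auto
  then have "pw x (a * 2 ^ n) = x \<cdot> pw x (j * b)" by (simp add: mult.commute)
  then have "x = pw (pw x a) (2 ^ n)"
    using j by (simp add: pw_mult)
  then show "x \<in> pow2_image n" by (auto simp: pow2_image_def)
next
  fix x assume "x \<in> pow2_image n"
  then show "x \<in> Kpart Q m e"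
    using assms by (auto simp: pow2_image_def Kpart_iff simp flip: pw_mult)
qed

section \<open>Normal subloops, as subloops invariant under inner maps, and their
  congruences\<close>

definition normal_subloop :: "'a set \<Rightarrow> bool" where
  "normal_subloop N \<longleftrightarrow> N \<subseteq> Q \<and> e \<in> N \<and> (\<forall>x\<in>N. \<forall>y\<in>N. x \<cdot> y \<in> N)
     \<and> (\<forall>x\<in>Q. \<forall>y\<in>Q. \<forall>u\<in>N. inner x y u \<in> N)"

text \<open>This relation plays the role of equality in the quotient loop \<open>Q/N\<close>, which
  is not constructed.\<close>

definition loop_cong :: "'a set \<Rightarrow> 'a \<Rightarrow> 'a \<Rightarrow> bool" where
  "loop_cong N x y \<longleftrightarrow> (\<exists>u\<in>N. y = x \<cdot> u)"

context
  fixes N assumes N: "normal_subloop N"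
begin

lemma normal_in_Q: "u \<in> N \<Longrightarrow> u \<in> Q"
  using N by (auto simp: normal_subloop_def)

lemma normal_loop: "finite_comm_A_loop N m e"
  using N by (intro subloopI) (auto simp: normal_subloop_def)

lemma inner_normal_surj:
  assumes "x \<in> Q" "y \<in> Q" "u \<in> N"
  shows "\<exists>v\<in>N. inner x y v = u"
proof -
  have "inj_on (inner x y) N"
    using assms by (auto simp: inj_on_def intro: inner_inj normal_in_Q)
  then have "inner x y ` N = N"
    using assms N finite_Q
    by (intro endo_inj_surj) (auto simp: normal_subloop_def intro: finite_subset)
  then show ?thesis using assms by (metis imageE)
qed

lemma loop_cong_e_iff: "loop_cong N e x \<longleftrightarrow> x \<in> N"
  by (auto simp: loop_cong_def normal_in_Q)

lemma loop_cong_closed: "\<lbrakk>loop_cong N x y; x \<in> Q\<rbrakk> \<Longrightarrow> y \<in> Q"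
  by (auto simp: loop_cong_def normal_in_Q)

lemma loop_cong_mult_left:
  assumes "loop_cong N x y" "x \<in> Q" "z \<in> Q"
  shows "loop_cong N (z \<cdot> x) (z \<cdot> y)"
proof -
  obtain u where u: "u \<in> N" "y = x \<cdot> u" using assms by (auto simp: loop_cong_def)
  then have "z \<cdot> y = z \<cdot> x \<cdot> inner z x u" using assms normal_in_Q by simp
  moreover have "inner z x u \<in> N" using u assms N by (auto simp: normal_subloop_def)
  ultimately show ?thesis by (auto simp: loop_cong_def)
qed

lemma loop_cong_sym:
  assumes "loop_cong N x y" "x \<in> Q"
  shows "loop_cong N y x"
proof -
  interpret N: finite_comm_A_loop N m e by (rule normal_loop)
  obtain u where u: "u \<in> N" "y = x \<cdot> u" using assms by (auto simp: loop_cong_def)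
  then obtain v where v: "v \<in> N" "u \<cdot> v = e" using N.div_exists N.e_closed by blast
  \<comment> \<open>Reassociating \<open>x \<cdot> (u \<cdot> v)\<close> costs an inner map on
    \<open>v\<close>, under which \<open>N\<close> is invariant.\<close>
  then have "x = x \<cdot> u \<cdot> inner x u v" using u assms by (simp add: normal_in_Q)
  moreover have "inner x u v \<in> N" using u v assms N normal_in_Q by (auto simp: normal_subloop_def)
  ultimately show ?thesis using u by (auto simp: loop_cong_def)
qed

text \<open>Writing \<open>v\<close> as \<open>inner x u w\<close> with \<open>w\<close> in
  \<open>N\<close> turns \<open>(x u) v\<close> into \<open>x (u w)\<close>; surjectivity of inner
  maps on \<open>N\<close> supplies \<open>w\<close>.\<close>

lemma loop_cong_trans:
  assumes "loop_cong N x y" "loop_cong N y z" "x \<in> Q"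
  shows "loop_cong N x z"
proof -
  obtain u v where uv: "u \<in> N" "y = x \<cdot> u" "v \<in> N" "z = y \<cdot> v"
    using assms by (auto simp: loop_cong_def)
  then obtain w where w: "w \<in> N" "inner x u w = v"
    using inner_normal_surj assms normal_in_Q by metis
  then have "z = x \<cdot> (u \<cdot> w)" using uv assms normal_in_Q by (metis m_inner)
  moreover have "u \<cdot> w \<in> N" using uv w N by (auto simp: normal_subloop_def)
  ultimately show ?thesis by (auto simp: loop_cong_def)
qed

lemma loop_cong_mult:
  assumes "loop_cong N x x'" "loop_cong N y y'" "x \<in> Q" "y \<in> Q"
  shows "loop_cong N (x \<cdot> y) (x' \<cdot> y')"
proof -
  have [simp]: "x' \<in> Q" "y' \<in> Q" using assms loop_cong_closed by blast+
  have "loop_cong N (x \<cdot> y) (x \<cdot> y')" using assms by (intro loop_cong_mult_left)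
  moreover have "loop_cong N (x \<cdot> y') (x' \<cdot> y')"
    using loop_cong_mult_left[of x x' y'] assms by (simp add: m_comm)
  ultimately show ?thesis using assms by (auto intro: loop_cong_trans)
qed

lemma loop_cong_mult_normal: "\<lbrakk>x \<in> Q; u \<in> N\<rbrakk> \<Longrightarrow> loop_cong N (x \<cdot> u) x"
  by (rule loop_cong_sym) (auto simp: loop_cong_def)

lemma loop_cong_normal_mult: "\<lbrakk>x \<in> Q; u \<in> N\<rbrakk> \<Longrightarrow> loop_cong N (u \<cdot> x) x"
  using loop_cong_mult_normal[of x u] by (simp add: m_comm normal_in_Q)

end

text \<open>If \<open>x\<^sup>2\<close> and \<open>y\<^sup>2\<close> lie in a normal subloop, then \<open>x\<close> and \<open>y\<close> are congruent to their
  inverses, hence so is \<open>x y\<close> because inversion is an automorphism.\<close>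

lemma normal_subloop_square_preimage:
  assumes N: "normal_subloop N"
  shows "normal_subloop {x \<in> Q. x \<cdot> x \<in> N}"
proof -
  have inv_cong: "loop_cong N (inv x) x" if "x \<in> Q" "x \<cdot> x \<in> N" for x
  proof -
    have "loop_cong N e (x \<cdot> x)" using that by (simp add: loop_cong_e_iff[OF N])
    then have "loop_cong N (inv x \<cdot> e) (inv x \<cdot> (x \<cdot> x))"
      using that by (intro loop_cong_mult_left[OF N]) simp_all
    then show ?thesis using that m_inv_left_commute[of x x] by simp
  qed
  have "x \<cdot> y \<cdot> (x \<cdot> y) \<in> N" if "x \<in> Q" "x \<cdot> x \<in> N" "y \<in> Q" "y \<cdot> y \<in> N" for x y
  proof -
    have "loop_cong N (inv (x \<cdot> y)) (x \<cdot> y)"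
      using that inv_cong loop_cong_mult[OF N] by (simp add: inv_mult)
    then have "loop_cong N (x \<cdot> y \<cdot> inv (x \<cdot> y)) (x \<cdot> y \<cdot> (x \<cdot> y))"
      using that by (intro loop_cong_mult_left[OF N]) simp_all
    then show ?thesis using that by (simp add: loop_cong_e_iff[OF N])
  qed
  then show ?thesis
    using N by (auto simp: normal_subloop_def simp flip: inner_hom)
qed

section \<open>Normality of \<open>H(Q)\<close> and \<open>K(Q)\<close>\<close>

lemma normal_subloop_pow2_kernel: "normal_subloop {x \<in> Q. pw x (2 ^ n) = e}"
proof (induction n)
  case 0
  have "{x \<in> Q. pw x (2 ^ 0) = e} = {e}" by auto
  then show ?case by (simp add: normal_subloop_def)
next
  case (Suc n)
  have "pw x (2 ^ Suc n) = pw (x \<cdot> x) (2 ^ n)" if "x \<in> Q" for x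
    using that pw_mult[of x 2 "2 ^ n"] by (simp add: pw_2)
  then have "{x \<in> Q. pw x (2 ^ Suc n) = e}
      = {x \<in> Q. x \<cdot> x \<in> {x \<in> Q. pw x (2 ^ n) = e}}" by auto
  then show ?case using normal_subloop_square_preimage[OF Suc] by simp
qed

lemma normal_subloop_Hpart: "normal_subloop (Hpart Q m e)"
proof -
  have "x \<cdot> y \<in> Hpart Q m e" if xy: "x \<in> Hpart Q m e" "y \<in> Hpart Q m e" for x y
  proof -
    obtain i j where "x \<in> Q" "pw x (2 ^ i) = e" "y \<in> Q" "pw y (2 ^ j) = e"
      using xy by (auto simp: Hpart_iff)
    \<comment> \<open>A common exponent puts both elements into a single kernel of the chain whose
      union is \<open>Hpart\<close>.\<close>
    then have "pw x (2 ^ (i + j)) = e" "pw y (2 ^ (i + j)) = e"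
      by (simp_all add: pw_eq_e_dvd[OF _ le_imp_power_dvd])
    then show ?thesis
      using normal_subloop_pow2_kernel[of "i + j"] \<open>x \<in> Q\<close> \<open>y \<in> Q\<close>
      by (auto simp: normal_subloop_def Hpart_iff)
  qed
  moreover have "inner x y u \<in> Hpart Q m e" if "x \<in> Q" "y \<in> Q" "u \<in> Hpart Q m e" for x y u
    using that unfolding Hpart_iff by (metis inner_closed inner_e inner_pw)
  ultimately show ?thesis by (auto simp: normal_subloop_def Hpart_iff)
qed

lemma normal_subloop_Kpart: "normal_subloop (Kpart Q m e)"
proof -
  obtain n k where "odd k" "\<And>x. x \<in> Q \<Longrightarrow> pw x (2 ^ n * k) = e"
    using exists_exponent by blast
  then have "Kpart Q m e = pow2_image n" by (rule Kpart_eq_pow2_image)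
  then interpret K: finite_comm_A_loop "Kpart Q m e" m e
    by (simp add: pow2_image_loop)
  have "inner x y u \<in> Kpart Q m e" if "x \<in> Q" "y \<in> Q" "u \<in> Kpart Q m e" for x y u
    using that by (auto simp: Kpart_iff simp flip: inner_pw)
  moreover have "Kpart Q m e \<subseteq> Q" by (auto simp: Kpart_def)
  ultimately show ?thesis by (simp add: normal_subloop_def)
qed

section \<open>The direct decomposition\<close>

lemma Kpart_Int_Hpart: "Kpart Q m e \<inter> Hpart Q m e = {e}"
proof -
  have "x = e" if KH: "x \<in> Kpart Q m e" "x \<in> Hpart Q m e" for x
  proof -
    obtain k n where x: "x \<in> Q" "odd k" "pw x k = e" "pw x (2 ^ n) = e"
      using KH unfolding Kpart_iff Hpart_iff by blast
    \<comment> \<open>Bezout for two coprime exponents that both kill \<open>x\<close>: the powers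
      with exponents \<open>2^n * a\<close> and \<open>k * b\<close> are \<open>e\<close>, which
      forces \<open>x = e\<close>.\<close>
    then obtain a b where "2 ^ n * a = k * b + 1"
      using bezout_nat[of "2 ^ n" k] by auto
    then have "pw x (2 ^ n * a) = x \<cdot> pw x (k * b)" by simp
    then show ?thesis using x by (simp add: pw_mult)
  qed
  then show ?thesis
    using normal_subloop_Kpart normal_subloop_Hpart by (auto simp: normal_subloop_def)
qed

lemma Kpart_Hpart_factor:
  assumes [simp]: "x \<in> Q"
  shows "\<exists>k\<in>Kpart Q m e. \<exists>h\<in>Hpart Q m e. x = k \<cdot> h"
proof -
  obtain n k where k: "odd k" "\<And>x. x \<in> Q \<Longrightarrow> pw x (2 ^ n * k) = e"
    using exists_exponent by blast
  have "coprime (2 ^ n) k" using k by simp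
  then obtain a b where ab: "2 ^ n * a = k * b + 1"
    using bezout_nat[of "2 ^ n" k] by auto
  define u where "u = pw x (k * b)"
  have "pw u (2 ^ n) = pw x (2 ^ n * k * b)"
    by (simp add: u_def ac_simps flip: pw_mult)
  then have u: "u \<in> Q" "pw u (2 ^ n) = e"
    using k by (simp_all add: u_def pw_mult)
  have "pw x (2 ^ n * a * k) = pw (pw x (2 ^ n * k)) a"
    by (simp add: ac_simps flip: pw_mult)
  then have "pw (pw x (2 ^ n * a)) k = e"
    using k by (simp add: pw_mult)
  then have "pw x (2 ^ n * a) \<in> Kpart Q m e"
    using k by (auto simp: Kpart_iff)
  \<comment> \<open>As \<open>u\<close> is killed by \<open>2^n\<close>, this power is its inverse;
    it cancels the extra factor in \<open>pw x (2 ^ n * a) = x \<cdot> u\<close>.\<close>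
  moreover have "pw u (2 ^ n - 1) \<in> Hpart Q m e"
    using u by (auto simp: Hpart_iff simp flip: pw_mult)
      (metis mult.commute pw_e pw_mult)
  moreover have "x = pw x (2 ^ n * a) \<cdot> pw u (2 ^ n - 1)"
  proof -
    have "pw x (2 ^ n * a) \<cdot> pw u (2 ^ n - 1) = pw x (k * b + 1 + k * b * (2 ^ n - 1))"
      by (simp only: u_def ab pw_add pw_mult assms)
    also have "k * b + 1 + k * b * (2 ^ n - 1) = k * b * 2 ^ n + 1"
      by (simp add: algebra_simps)
    also have "pw x \<dots> = x"
      using u by (simp add: u_def pw_mult)
    finally show ?thesis ..
  qed
  ultimately show ?thesis by blast
qed

text \<open>Elements congruent modulo both \<open>K\<close> and \<open>H\<close> are equal, since
  the two meet trivially. The product rule is therefore checked modulo \<open>K\<close>, where only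
  the \<open>H\<close>-factors survive, and modulo \<open>H\<close>, where only the
  \<open>K\<close>-factors survive.\<close>

lemma direct_product_of_normal:
  assumes K: "normal_subloop K" and H: "normal_subloop H" and KH: "K \<inter> H = {e}"
    and factor: "\<And>x. x \<in> Q \<Longrightarrow> \<exists>k\<in>K. \<exists>h\<in>H. x = k \<cdot> h"
  shows "internal_direct_product Q m K H"
proof -
  note inQ [simp] = normal_in_Q[OF K] normal_in_Q[OF H]
  interpret K: finite_comm_A_loop K m e by (rule normal_loop[OF K])
  interpret H: finite_comm_A_loop H m e by (rule normal_loop[OF H])
  have eqI: "x = y" if cong: "loop_cong K x y" "loop_cong H x y" and x: "x \<in> Q" for x y
  proof -
    obtain k h where "k \<in> K" "h \<in> H" "y = x \<cdot> k" "y = x \<cdot> h"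
      using cong by (auto simp: loop_cong_def)
    then have "k = h" using x by (intro m_cancel[of x k h]) simp_all
    then have "k = e" using KH \<open>k \<in> K\<close> \<open>h \<in> H\<close> by blast
    then show ?thesis using \<open>y = x \<cdot> k\<close> x by simp
  qed
  have "k1 = k2 \<and> h1 = h2"
    if in_KH: "k1 \<in> K" "h1 \<in> H" "k2 \<in> K" "h2 \<in> H" and eq: "k1 \<cdot> h1 = k2 \<cdot> h2" for k1 h1 k2 h2
  proof -
    have "loop_cong H k1 (k1 \<cdot> h1)" "loop_cong H (k2 \<cdot> h2) k2"
      using in_KH loop_cong_mult_normal[OF H, of k2 h2] by (auto simp: loop_cong_def)
    then have "loop_cong H k1 k2"
      using in_KH eq loop_cong_trans[OF H] by simp
    moreover have "loop_cong K k1 k2"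
      using in_KH K.div_exists unfolding loop_cong_def by metis
    ultimately have "k1 = k2" using eqI in_KH by simp
    then show ?thesis using eq in_KH m_cancel[of k1 h1 h2] by simp
  qed
  then have "inj_on (\<lambda>(k, h). k \<cdot> h) (K \<times> H)"
    by (auto simp: inj_on_def)
  moreover have "(\<lambda>(k, h). k \<cdot> h) ` (K \<times> H) = Q"
    using factor by force
  moreover have "k1 \<cdot> h1 \<cdot> (k2 \<cdot> h2) = k1 \<cdot> k2 \<cdot> (h1 \<cdot> h2)"
    if in_KH: "k1 \<in> K" "k2 \<in> K" "h1 \<in> H" "h2 \<in> H" for k1 k2 h1 h2
  proof (rule eqI)
    have "loop_cong K (k1 \<cdot> h1 \<cdot> (k2 \<cdot> h2)) (h1 \<cdot> h2)"
      using in_KH by (intro loop_cong_mult[OF K] loop_cong_normal_mult[OF K]) simp_all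
    moreover have "loop_cong K (h1 \<cdot> h2) (k1 \<cdot> k2 \<cdot> (h1 \<cdot> h2))"
      using in_KH by (auto intro: loop_cong_sym[OF K loop_cong_normal_mult[OF K]])
    ultimately show "loop_cong K (k1 \<cdot> h1 \<cdot> (k2 \<cdot> h2)) (k1 \<cdot> k2 \<cdot> (h1 \<cdot> h2))"
      using in_KH by (auto elim: loop_cong_trans[OF K])
    have "loop_cong H (k1 \<cdot> h1 \<cdot> (k2 \<cdot> h2)) (k1 \<cdot> k2)"
      using in_KH by (intro loop_cong_mult[OF H] loop_cong_mult_normal[OF H]) simp_all
    moreover have "loop_cong H (k1 \<cdot> k2) (k1 \<cdot> k2 \<cdot> (h1 \<cdot> h2))"
      using in_KH unfolding loop_cong_def by auto
    ultimately show "loop_cong H (k1 \<cdot> h1 \<cdot> (k2 \<cdot> h2)) (k1 \<cdot> k2 \<cdot> (h1 \<cdot> h2))"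
      using in_KH by (auto elim: loop_cong_trans[OF H])
  qed (use in_KH in simp_all)
  ultimately show ?thesis
    by (auto simp: internal_direct_product_def bij_betw_def)
qed

lemma is_subloop_of_normal: "normal_subloop N \<Longrightarrow> is_subloop N Q m e"
  using normal_loop[of N] comm_A_loop.is_loop[of N m e]
  by (auto simp: is_subloop_def normal_subloop_def finite_comm_A_loop_def)

end

section \<open>From the definition by inner mappings to the locale axioms\<close>

lemma is_comm_A_loop_imp_comm_A_loop:
  assumes "is_comm_A_loop Q m e"
  shows "comm_A_loop Q m e"
proof
  have loop: "is_loop Q m e" and comm: "\<And>x y. \<lbrakk>x \<in> Q; y \<in> Q\<rbrakk> \<Longrightarrow> m x y = m y x"
    using assms by (auto simp: is_comm_A_loop_def)
  show "e \<in> Q" and closed: "\<And>x y. \<lbrakk>x \<in> Q; y \<in> Q\<rbrakk> \<Longrightarrow> m x y \<in> Q"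
    and "\<And>x. x \<in> Q \<Longrightarrow> m e x = x"
    using loop by (auto simp: is_loop_def)
  have unit: "\<And>x. x \<in> Q \<Longrightarrow> m x e = x"
    using loop by (auto simp: is_loop_def)
  have bij: "bij_betw (m x) Q Q" if "x \<in> Q" for x
    using that loop by (auto simp: is_loop_def)
  show "m x y = m y x" if "x \<in> Q" "y \<in> Q" for x y using that comm by blast
  show "\<exists>z\<in>Q. m x z = y" if "x \<in> Q" "y \<in> Q" for x y
    using that bij[of x] by (metis bij_betw_imp_surj_on imageE)
  show cancel: "y = z" if "m x y = m x z" "x \<in> Q" "y \<in> Q" "z \<in> Q" for x y z
    using that bij[of x] by (meson bij_betw_imp_inj_on inj_onD)
  fix x y u u' v v'
  assume eqs: "m x (m y u) = m (m x y) u'" "m x (m y v) = m (m x y) v'"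
    and Q: "x \<in> Q" "y \<in> Q" "u \<in> Q" "v \<in> Q" "u' \<in> Q" "v' \<in> Q"
  \<comment> \<open>The inner map of \<open>x\<close> and \<open>y\<close> as an explicit member of
    \<open>mlt Q m\<close>; the hypotheses say that it sends \<open>u\<close> to \<open>u'\<close>
    and \<open>v\<close> to \<open>v'\<close>.\<close>
  define f where "f = lmap_inv Q m (m x y) \<circ> (lmap Q m x \<circ> (lmap Q m y \<circ> id))"
  have f: "f w = w'" if "m x (m y w) = m (m x y) w'" "w \<in> Q" "w' \<in> Q" for w w'
  proof -
    have "(THE z. z \<in> Q \<and> m (m x y) z = m (m x y) w') = w'"
      using that Q closed cancel[of "m x y"] by (intro the_equality) blast+
    then show ?thesis using that Q closed by (simp add: f_def lmap_def lmap_inv_def)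
  qed
  have "f \<in> mlt Q m"
    unfolding f_def using Q closed by (intro mlt.intros) auto
  moreover have "f e = e"
    using Q closed \<open>e \<in> Q\<close> unit by (intro f) auto
  ultimately have "f \<in> inn Q m e" by (simp add: inn_def)
  then have "f (m u v) = m (f u) (f v)"
    using assms Q by (auto simp: is_comm_A_loop_def)
  then have fuv: "f (m u v) = m u' v'"
    using f eqs Q by simp
  have "m x (m y (m u v)) \<in> Q" "m x y \<in> Q" using Q closed by auto
  \<comment> \<open>Solving for the value of \<open>f\<close> at \<open>m u v\<close> allows its
    multiplicativity to be restated as an equation without division.\<close>
  then obtain w where w: "w \<in> Q" "m (m x y) w = m x (m y (m u v))"
    using bij[of "m x y"] by (metis bij_betw_imp_surj_on imageE)
  then have "f (m u v) = w" using Q closed by (intro f) auto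
  then show "m x (m y (m u v)) = m (m x y) (m u' v')" using w fuv by simp
qed

theorem theorem5p1:
  fixes Q :: "'a set" and m :: "'a \<Rightarrow> 'a \<Rightarrow> 'a" and e :: 'a
  assumes "finite Q" and "is_comm_A_loop Q m e"
  shows "is_subloop (Kpart Q m e) Q m e \<and> is_subloop (Hpart Q m e) Q m e
         \<and> internal_direct_product Q m (Kpart Q m e) (Hpart Q m e)"
proof -
  interpret finite_comm_A_loop Q m e
    using assms by (simp add: finite_comm_A_loop_def finite_comm_A_loop_axioms_def
        is_comm_A_loop_imp_comm_A_loop)
  show ?thesis
    using normal_subloop_Kpart normal_subloop_Hpart Kpart_Int_Hpart Kpart_Hpart_factor
    by (intro conjI is_subloop_of_normal direct_product_of_normal)
qed

end
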